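(* Let $n\ge 1$, let $\Omega$ be a finite subset of $\mathbb{Z}^n$ with $\sharp\Omega\geq 2$, and let $\lambda_i$ be the $i$-th eigenvalue of the Dirichlet Laplacian on $\Omega$. Then $$\lambda_2-\lambda_1\leq \frac{4\lambda_1}{n(1-\lambda_1)},$$ where the right-hand side is to be interpreted as infinity if $\lambda_1=1$. Moreover, $$\lambda_2\leq 9\lambda_1.$$
   Context: $\mathbb{Z}^n$ denotes the integer lattice graph: vertex set $\mathbb{Z}^n$, with $x\sim y$ (neighbors) iff $\sum_{i=1}^n|x_i-y_i|=1$; every vertex has degree $d_x=2n$. The discrete Laplacian is $\Delta f(x)=\frac{1}{d_x}\sum_{y\sim x}f(y)-f(x)$ for $f:\mathbb{Z}^n\to\mathbb{R}$. For a finite subset $\Omega\subset\mathbb{Z}^n$ and $f:\Omega\to\mathbb{R}$, the Dirichlet Laplacian is $\Delta_\Omega f(x)=\Delta\widetilde f(x)$ for $x\in\Omega$, where $\widetilde f$ is the extension of $f$ by $0$ to $\mathbb{Z}^n$. It is self-adjoint on functions on $\Omega$ with inner product $\langle f,g\rangle=\sum_{x\in\Omega}f(x)g(x)d_x$. The eigenvalues of the Dirichlet Laplacian on $\Omega$ are the eigenvalues of $-\Delta_\Omega$, listed in non-decreasing order with multiplicity: $0<\lambda_1\le\lambda_2\le\cdots\le\lambda_N\le 2$, where $N=\sharp\Omega$ is the number of vertices of $\Omega$. *)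

theory Defs
  imports "HOL-Analysis.Analysis" "HOL-Library.Function_Algebras"
begin

text \<open>The integer lattice graph on \<open>int ^ 'n\<close>, of dimension \<open>n = CARD('n)\<close>.\<close>

definition lattice_nbrs :: "int ^ 'n \<Rightarrow> (int ^ 'n) set" where
  "lattice_nbrs x = {y. (\<Sum>i\<in>UNIV. \<bar>x $ i - y $ i\<bar>) = 1}"

definition lattice_degree :: "int ^ 'n \<Rightarrow> nat" where
  "lattice_degree x = card (lattice_nbrs x)"

definition laplacian :: "(int ^ 'n \<Rightarrow> real) \<Rightarrow> int ^ 'n \<Rightarrow> real" where
  "laplacian f x = (\<Sum>y\<in>lattice_nbrs x. f y) / real (lattice_degree x) - f x"

definition extend_by_zero :: "'a set \<Rightarrow> ('a \<Rightarrow> real) \<Rightarrow> 'a \<Rightarrow> real" where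
  "extend_by_zero \<Omega> f = (\<lambda>x. if x \<in> \<Omega> then f x else 0)"

text \<open>The real vector space of functions \<open>\<Omega> \<rightarrow> \<real>\<close> is represented by the functions on the
  whole type that vanish outside \<open>\<Omega>\<close>.\<close>

definition functions_on :: "'a set \<Rightarrow> ('a \<Rightarrow> real) set" where
  "functions_on \<Omega> = {f. \<forall>x. x \<notin> \<Omega> \<longrightarrow> f x = 0}"

definition dirichlet_laplacian ::
    "(int ^ 'n) set \<Rightarrow> (int ^ 'n \<Rightarrow> real) \<Rightarrow> int ^ 'n \<Rightarrow> real" where
  "dirichlet_laplacian \<Omega> f =
     extend_by_zero \<Omega> (laplacian (extend_by_zero \<Omega> f))"

definition fun_scale :: "real \<Rightarrow> ('a \<Rightarrow> real) \<Rightarrow> 'a \<Rightarrow> real" where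
  "fun_scale c f = (\<lambda>x. c * f x)"

interpretation fun_space: vector_space "fun_scale :: real \<Rightarrow> ('a \<Rightarrow> real) \<Rightarrow> 'a \<Rightarrow> real"
  by unfold_locales (auto simp: fun_scale_def fun_eq_iff algebra_simps)

definition dirichlet_eigenspace :: "(int ^ 'n) set \<Rightarrow> real \<Rightarrow> (int ^ 'n \<Rightarrow> real) set" where
  "dirichlet_eigenspace \<Omega> \<mu> =
     {f \<in> functions_on \<Omega>. - dirichlet_laplacian \<Omega> f = fun_scale \<mu> f}"

definition dirichlet_spectrum :: "(int ^ 'n) set \<Rightarrow> real set" where
  "dirichlet_spectrum \<Omega> = {\<mu>. \<exists>f\<in>dirichlet_eigenspace \<Omega> \<mu>. f \<noteq> 0}"

text \<open>All eigenvalues in non-decreasing order, each repeated according to the dimension of its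
  eigenspace.  For finite \<open>\<Omega>\<close> the spectrum is finite, so \<open>sorted_list_of_set\<close> enumerates it,
  and by self-adjointness the list has \<open>card \<Omega>\<close> entries.\<close>

definition dirichlet_eigenvalues :: "(int ^ 'n) set \<Rightarrow> real list" where
  "dirichlet_eigenvalues \<Omega> =
     concat (map (\<lambda>\<mu>. replicate (fun_space.dim (dirichlet_eigenspace \<Omega> \<mu>)) \<mu>)
       (sorted_list_of_set (dirichlet_spectrum \<Omega>)))"

text \<open>Numbering starts at 1; only \<open>1 \<le> i \<le> card \<Omega>\<close> is meaningful.\<close>

definition dirichlet_eigenvalue :: "(int ^ 'n) set \<Rightarrow> nat \<Rightarrow> real" where
  "dirichlet_eigenvalue \<Omega> i = dirichlet_eigenvalues \<Omega> ! (i - 1)"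

end

theory Submission imports Defs begin

text \<open>
  Let \<open>u\<close> be a normalised first eigenfunction and \<open>c\<^sub>i = \<Sum>\<^sub>x u(x) u(x + e\<^sub>i)\<close>, so that
  \<open>\<Sum>\<^sub>i c\<^sub>i = n (1 - \<lambda>\<^sub>1)\<close>.  The trial function \<open>f = (x\<^sub>i - a) u\<close>, with \<open>a\<close> chosen to make \<open>f\<close>
  orthogonal to \<open>u\<close>, gives \<open>(\<lambda>\<^sub>2 - \<lambda>\<^sub>1) \<parallel>f\<parallel>\<^sup>2 \<le> c\<^sub>i / (2n)\<close>, because its excess energy is a multiple of
  \<open>\<Sum>\<^sub>x f(x) (u(x + e\<^sub>i) - u(x - e\<^sub>i)) = - c\<^sub>i\<close>.  The Cauchy--Schwarz inequality for the same sum gives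
  \<open>c\<^sub>i\<^sup>2 \<le> 8 (1 - c\<^sub>i) \<parallel>f\<parallel>\<^sup>2\<close>.  Hence \<open>(\<lambda>\<^sub>2 - \<lambda>\<^sub>1) c\<^sub>i \<le> 4 (1 - c\<^sub>i) / n\<close>, and summing over \<open>i\<close> yields the
  gap bound.  It implies \<open>\<lambda>\<^sub>2 \<le> 9 \<lambda>\<^sub>1\<close> if \<open>\<lambda>\<^sub>1 \<le> 1/2\<close>; otherwise \<open>\<lambda>\<^sub>2 \<le> 2\<close> suffices.
\<close>

section \<open>Symmetric kernels on finite sets\<close>

text \<open>Every vertex has degree \<open>2n\<close>, so the degree-weighted inner product is
  \<open>2n\<close> times this one. Orthogonality, self-adjointness and Rayleigh quotients are the
  same for both.\<close>

definition inner_on :: "'a set \<Rightarrow> ('a \<Rightarrow> real) \<Rightarrow> ('a \<Rightarrow> real) \<Rightarrow> real" where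
  "inner_on \<Omega> f g = (\<Sum>x\<in>\<Omega>. f x * g x)"

lemma inner_on_commute: "inner_on \<Omega> f g = inner_on \<Omega> g f"
  by (simp add: inner_on_def mult.commute)

lemma inner_on_add_left: "inner_on \<Omega> (f + g) h = inner_on \<Omega> f h + inner_on \<Omega> g h"
  by (simp add: inner_on_def sum.distrib algebra_simps)

lemma inner_on_diff_left: "inner_on \<Omega> (f - g) h = inner_on \<Omega> f h - inner_on \<Omega> g h"
  by (simp add: inner_on_def sum_subtractf algebra_simps)

lemma inner_on_diff_right: "inner_on \<Omega> h (f - g) = inner_on \<Omega> h f - inner_on \<Omega> h g"
  by (simp add: inner_on_def sum_subtractf algebra_simps)

lemma inner_on_scale_left: "inner_on \<Omega> (fun_scale c f) h = c * inner_on \<Omega> f h"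
  by (simp add: inner_on_def fun_scale_def sum_distrib_left algebra_simps)

lemma inner_on_add_right: "inner_on \<Omega> h (f + g) = inner_on \<Omega> h f + inner_on \<Omega> h g"
  by (simp add: inner_on_def sum.distrib algebra_simps)

lemma inner_on_scale_right: "inner_on \<Omega> h (fun_scale c f) = c * inner_on \<Omega> h f"
  by (simp add: inner_on_def fun_scale_def sum_distrib_left algebra_simps)

lemma inner_on_zero_left: "inner_on \<Omega> 0 h = 0"
  by (simp add: inner_on_def)

lemma inner_on_zero_right: "inner_on \<Omega> h 0 = 0"
  by (simp add: inner_on_def)

lemma inner_on_sum_left:
  "finite S \<Longrightarrow> inner_on \<Omega> (\<Sum>v\<in>S. F v) h = (\<Sum>v\<in>S. inner_on \<Omega> (F v) h)"
  by (induction S rule: finite_induct)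
     (simp_all only: not_False_eq_True sum.empty sum.insert inner_on_zero_left inner_on_add_left)

lemma inner_on_self_nonneg: "inner_on \<Omega> f f \<ge> 0"
  by (simp add: inner_on_def sum_nonneg)

lemma inner_on_self_pos:
  assumes "finite \<Omega>" "f \<in> functions_on \<Omega>" "f \<noteq> 0"
  shows "inner_on \<Omega> f f > 0"
proof -
  obtain x where x: "f x \<noteq> 0" using assms(3) by (auto simp: fun_eq_iff)
  with assms(2) have "x \<in> \<Omega>" by (auto simp: functions_on_def)
  with x show ?thesis
    unfolding inner_on_def using assms(1) by (intro sum_pos2[of _ x]) (auto simp: zero_less_mult_iff)
qed

section \<open>Finite dimension and orthogonal families\<close>

lemma subspace_functions_on: "fun_space.subspace (functions_on \<Omega>)"
  by (auto simp: fun_space.subspace_def functions_on_def fun_scale_def)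

text \<open>The point masses at the elements of \<Omega> span. A finite spanning set is what bounds
  the size of independent families inside the space of all functions.\<close>

lemma functions_on_finite_spanning:
  assumes "finite \<Omega>"
  obtains T where "finite T" "functions_on \<Omega> \<subseteq> fun_space.span T"
proof
  define d :: "'a \<Rightarrow> 'a \<Rightarrow> real" where "d = (\<lambda>a x. if x = a then 1 else 0)"
  show "finite (d ` \<Omega>)" using assms by simp
  show "functions_on \<Omega> \<subseteq> fun_space.span (d ` \<Omega>)"
  proof
    fix f assume f: "f \<in> functions_on \<Omega>"
    have sum_apply: "(\<Sum>a\<in>S. fun_scale (f a) (d a)) x = (\<Sum>a\<in>S. f a * d a x)" if "finite S" for S x
      using that by (induction S rule: finite_induct) (auto simp: fun_scale_def)
    have "f = (\<Sum>a\<in>\<Omega>. fun_scale (f a) (d a))"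
    proof
      fix x
      have "(\<Sum>a\<in>\<Omega>. f a * d a x) = (\<Sum>a\<in>\<Omega>. if a = x then f x else 0)"
        by (rule sum.cong) (auto simp: d_def)
      with f show "f x = (\<Sum>a\<in>\<Omega>. fun_scale (f a) (d a)) x"
        using assms by (auto simp: sum_apply functions_on_def)
    qed
    also have "\<dots> \<in> fun_space.span (d ` \<Omega>)"
      by (intro fun_space.span_sum fun_space.span_scale fun_space.span_base) auto
    finally show "f \<in> fun_space.span (d ` \<Omega>)" .
  qed
qed

text \<open>Pairing a vanishing linear combination with one of its members \<open>g\<close> leaves
  only the coefficient of \<open>g\<close> times a positive number.\<close>

lemma orthogonal_independent:
  assumes "finite \<Omega>" "S \<subseteq> functions_on \<Omega>" "0 \<notin> S"
    and orth: "\<And>f g. f \<in> S \<Longrightarrow> g \<in> S \<Longrightarrow> f \<noteq> g \<Longrightarrow> inner_on \<Omega> f g = 0"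
  shows "fun_space.independent S"
  unfolding fun_space.independent_explicit_finite_subsets
proof (intro allI impI ballI)
  fix T c g assume T: "T \<subseteq> S" "finite T" and z: "(\<Sum>v\<in>T. fun_scale (c v) v) = 0" and g: "g \<in> T"
  have "0 = inner_on \<Omega> (\<Sum>v\<in>T. fun_scale (c v) v) g"
    by (simp add: z inner_on_zero_left)
  also have "\<dots> = (\<Sum>v\<in>T. c v * inner_on \<Omega> v g)"
    using T by (simp add: inner_on_sum_left inner_on_scale_left)
  also have "\<dots> = (\<Sum>v\<in>T. if v = g then c g * inner_on \<Omega> g g else 0)"
    by (rule sum.cong) (use T g orth in auto)
  also have "\<dots> = c g * inner_on \<Omega> g g"
    using T g by simp
  finally show "c g = 0"
    using inner_on_self_pos[of \<Omega> g] assms T g by (metis less_irrefl mult_eq_0_iff subsetD)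
qed

text \<open>A basis of \<open>E\<close> is finite by comparison with the point masses, and the
  independent set \<open>S\<close> lies in its span. The lemma bounds multiplicities from below and
  also shows that the spectrum is finite.\<close>

lemma orthogonal_card_le_dim:
  assumes fin: "finite \<Omega>" and E: "E \<subseteq> functions_on \<Omega>" and S: "S \<subseteq> E" "0 \<notin> S"
    and orth: "\<And>f g. f \<in> S \<Longrightarrow> g \<in> S \<Longrightarrow> f \<noteq> g \<Longrightarrow> inner_on \<Omega> f g = 0"
  shows "finite S \<and> card S \<le> fun_space.dim E"
proof -
  obtain T where T: "finite T" "functions_on \<Omega> \<subseteq> fun_space.span T"
    using functions_on_finite_spanning[OF fin] .
  obtain B where B: "B \<subseteq> E" "fun_space.independent B" "E \<subseteq> fun_space.span B"
      "card B = fun_space.dim E"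
    using fun_space.basis_exists[of E] .
  have "finite B"
    using fun_space.independent_span_bound[OF T(1) B(2)] B(1) E T(2) by blast
  moreover have "fun_space.independent S"
    by (rule orthogonal_independent[OF fin _ S(2) orth]) (use S E in auto)
  ultimately show ?thesis
    using fun_space.independent_span_bound[of B S] B(3,4) S(1) by auto
qed

section \<open>Symmetric operators and constrained Rayleigh minima\<close>

definition kernel_op :: "'a set \<Rightarrow> ('a \<Rightarrow> 'a \<Rightarrow> real) \<Rightarrow> ('a \<Rightarrow> real) \<Rightarrow> 'a \<Rightarrow> real" where
  "kernel_op \<Omega> M f = (\<lambda>x. if x \<in> \<Omega> then \<Sum>y\<in>\<Omega>. M x y * f y else 0)"

lemma kernel_op_functions_on: "kernel_op \<Omega> M f \<in> functions_on \<Omega>"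
  by (simp add: kernel_op_def functions_on_def)

lemma kernel_op_add: "kernel_op \<Omega> M (f + g) = kernel_op \<Omega> M f + kernel_op \<Omega> M g"
  by (auto simp: kernel_op_def fun_eq_iff sum.distrib algebra_simps)

lemma kernel_op_scale: "kernel_op \<Omega> M (fun_scale c f) = fun_scale c (kernel_op \<Omega> M f)"
  by (auto simp: kernel_op_def fun_eq_iff fun_scale_def sum_distrib_left algebra_simps)

lemma kernel_op_symmetric:
  assumes "\<And>x y. M x y = M y x"
  shows "inner_on \<Omega> (kernel_op \<Omega> M f) g = inner_on \<Omega> f (kernel_op \<Omega> M g)"
proof -
  have "inner_on \<Omega> (kernel_op \<Omega> M f) g = (\<Sum>x\<in>\<Omega>. \<Sum>y\<in>\<Omega>. M x y * f y * g x)"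
    by (simp add: inner_on_def kernel_op_def sum_distrib_right)
  also have "\<dots> = (\<Sum>y\<in>\<Omega>. \<Sum>x\<in>\<Omega>. M x y * f y * g x)"
    by (rule sum.swap)
  also have "\<dots> = inner_on \<Omega> f (kernel_op \<Omega> M g)"
    unfolding inner_on_def kernel_op_def
    by (intro sum.cong refl) (simp add: sum_distrib_left assms mult_ac)
  finally show ?thesis .
qed

text \<open>In the product topology this is a closed subset of a product of the compact factors
  \<open>[-1, 1]\<close> (on \<Omega>) and \<open>{0}\<close> (elsewhere), so Tychonoff's theorem
  applies.\<close>

lemma compact_orthogonal_unit_sphere:
  assumes "finite \<Omega>"
  shows "compact {f \<in> functions_on \<Omega>. inner_on \<Omega> f g = 0 \<and> inner_on \<Omega> f f = 1}"
proof -
  let ?B = "PiE UNIV (\<lambda>x. if x \<in> \<Omega> then {-1..1::real} else {0})"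
  let ?C = "{f. inner_on \<Omega> f g = 0 \<and> inner_on \<Omega> f f = 1}"
  have "compactin (product_topology (\<lambda>x. euclidean) UNIV) ?B"
    by (subst compactin_PiE) (auto simp: compactin_euclidean_iff)
  then have "compact ?B"
    by (simp add: euclidean_product_topology flip: compactin_euclidean_iff)
  moreover have "closed ?C"
    unfolding inner_on_def
    by (intro closed_Collect_conj closed_Collect_eq continuous_intros continuous_on_product_coordinates)
  ultimately have "compact (?B \<inter> ?C)" by (rule compact_Int_closed)
  also have "?B \<inter> ?C = {f \<in> functions_on \<Omega>. inner_on \<Omega> f g = 0 \<and> inner_on \<Omega> f f = 1}"
  proof -
    have "\<bar>f x\<bar> \<le> 1" if "inner_on \<Omega> f f = 1" "x \<in> \<Omega>" for f x
    proof -
      have "f x * f x \<le> inner_on \<Omega> f f"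
        unfolding inner_on_def by (rule member_le_sum) (use that assms in auto)
      with that show ?thesis by (simp flip: abs_square_le_1 add: power2_eq_square)
    qed
    then show ?thesis by (fastforce simp: functions_on_def PiE_iff abs_le_iff split: if_splits)
  qed
  finally show ?thesis .
qed

lemma nonneg_quadratic_imp_linear_zero:
  fixes b q :: real
  assumes "\<And>t. 2 * t * b + t\<^sup>2 * q \<ge> 0"
  shows "b = 0"
proof (rule ccontr)
  assume "b \<noteq> 0"
  \<comment> \<open>At \<open>t = - b / k\<close> the linear term is \<open>- 2 b^2 / k\<close> and
    the quadratic term is smaller than \<open>b^2 / k\<close>, because \<open>q < k\<close>.\<close>
  define k where "k = \<bar>q\<bar> + 1"
  have k: "k > 0" "q < k" by (auto simp: k_def)
  have "2 * (- b / k) * b + (- b / k)\<^sup>2 * q = b\<^sup>2 / k * (q / k - 2)"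
    using k by (simp add: field_simps power2_eq_square)
  moreover have "b\<^sup>2 / k > 0" "q / k - 2 < 0" using k \<open>b \<noteq> 0\<close> by (auto simp: field_simps)
  ultimately have "2 * (- b / k) * b + (- b / k)\<^sup>2 * q < 0" by (metis mult_pos_neg)
  with assms[of "- b / k"] show False by linarith
qed

text \<open>Compactness gives a minimiser \<open>v\<close> of the energy on the unit sphere
  orthogonal to \<open>g\<close>. Since \<open>g\<close> is an eigenfunction, its orthogonal
  complement is invariant, so \<open>v\<close> is an eigenfunction and not merely a constrained
  critical point.\<close>

lemma rayleigh_minimizer:
  fixes M :: "'a \<Rightarrow> 'a \<Rightarrow> real"
  assumes fin: "finite \<Omega>" and sym: "\<And>x y. M x y = M y x"
    and g: "kernel_op \<Omega> M g = fun_scale c g"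
    and f0: "f0 \<in> functions_on \<Omega>" "inner_on \<Omega> f0 g = 0" "f0 \<noteq> 0"
  obtains v m where "v \<in> functions_on \<Omega>" "inner_on \<Omega> v g = 0" "inner_on \<Omega> v v = 1"
    "kernel_op \<Omega> M v = fun_scale m v"
    "\<And>f. f \<in> functions_on \<Omega> \<Longrightarrow> inner_on \<Omega> f g = 0 \<Longrightarrow>
        m * inner_on \<Omega> f f \<le> inner_on \<Omega> f (kernel_op \<Omega> M f)"
proof -
  let ?L = "kernel_op \<Omega> M"
  define S where "S = {f \<in> functions_on \<Omega>. inner_on \<Omega> f g = 0 \<and> inner_on \<Omega> f f = 1}"
  have normalize: "fun_scale (1 / sqrt (inner_on \<Omega> f f)) f \<in> S"
    if "f \<in> functions_on \<Omega>" "inner_on \<Omega> f g = 0" "f \<noteq> 0" for f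
    using that inner_on_self_pos[OF fin that(1,3)] fun_space.subspace_scale[OF subspace_functions_on that(1)]
    by (auto simp: S_def inner_on_scale_left inner_on_scale_right field_simps)
  have "continuous_on S (\<lambda>f. inner_on \<Omega> f (?L f))"
    unfolding inner_on_def kernel_op_def
    by (intro continuous_intros continuous_on_subset[OF continuous_on_product_coordinates])
       (auto intro!: continuous_intros continuous_on_subset[OF continuous_on_product_coordinates])
  moreover have "compact S" unfolding S_def by (rule compact_orthogonal_unit_sphere[OF fin])
  moreover have "S \<noteq> {}" using normalize f0 by blast
  ultimately obtain v where v: "v \<in> S" and vmin: "\<And>f. f \<in> S \<Longrightarrow> inner_on \<Omega> v (?L v) \<le> inner_on \<Omega> f (?L f)"
    using continuous_attains_inf by metis
  define m where "m = inner_on \<Omega> v (?L v)"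
  have vS: "v \<in> functions_on \<Omega>" "inner_on \<Omega> v g = 0" "inner_on \<Omega> v v = 1"
    using v by (auto simp: S_def)
  have min: "m * inner_on \<Omega> f f \<le> inner_on \<Omega> f (?L f)"
    if f: "f \<in> functions_on \<Omega>" "inner_on \<Omega> f g = 0" for f
  proof (cases "f = 0")
    case False
    have pos: "inner_on \<Omega> f f > 0" by (rule inner_on_self_pos[OF fin f(1) False])
    have "m \<le> (1 / sqrt (inner_on \<Omega> f f))\<^sup>2 * inner_on \<Omega> f (?L f)"
      using vmin[OF normalize[OF f False]]
      by (simp add: m_def kernel_op_scale inner_on_scale_left inner_on_scale_right power2_eq_square mult_ac)
    with pos show ?thesis by (simp add: power_divide field_simps)
  qed (simp add: inner_on_zero_left)
  \<comment> \<open>The residual of the eigenvalue equation is itself an admissible direction: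
    symmetry moves the operator onto the eigenfunction \<open>g\<close>.\<close>
  define r where "r = ?L v - fun_scale m v"
  have r: "r \<in> functions_on \<Omega>"
    unfolding r_def by (intro fun_space.subspace_diff[OF subspace_functions_on]
        fun_space.subspace_scale[OF subspace_functions_on] kernel_op_functions_on vS)
  have rg: "inner_on \<Omega> r g = 0"
    by (simp add: r_def inner_on_diff_left inner_on_scale_left vS kernel_op_symmetric[OF sym] g
        inner_on_scale_right)
  \<comment> \<open>Minimality along \<open>v + t r\<close> makes a quadratic in \<open>t\<close>
    without constant term nonnegative. Its linear coefficient is twice the squared norm of
    \<open>r\<close>.\<close>
  have "inner_on \<Omega> r r = 0"
  proof (rule nonneg_quadratic_imp_linear_zero)
    fix t :: real
    let ?f = "v + fun_scale t r"
    have "?f \<in> functions_on \<Omega>"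
      by (intro fun_space.subspace_add[OF subspace_functions_on]
        fun_space.subspace_scale[OF subspace_functions_on] r vS)
    moreover have "inner_on \<Omega> ?f g = 0"
      by (simp add: inner_on_add_left inner_on_scale_left vS rg)
    ultimately have *: "m * inner_on \<Omega> ?f ?f \<le> inner_on \<Omega> ?f (?L ?f)" by (rule min)
    have rv: "inner_on \<Omega> r v = inner_on \<Omega> v r" by (rule inner_on_commute)
    have vLr: "inner_on \<Omega> v (?L r) = inner_on \<Omega> r (?L v)"
      using kernel_op_symmetric[of M \<Omega> v r, OF sym] by (simp add: inner_on_commute)
    have rr: "inner_on \<Omega> r r = inner_on \<Omega> r (?L v) - m * inner_on \<Omega> v r"
      by (subst (2) r_def) (simp add: inner_on_diff_right inner_on_scale_right rv)
    have e1: "inner_on \<Omega> ?f ?f = 1 + 2 * t * inner_on \<Omega> v r + t\<^sup>2 * inner_on \<Omega> r r"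
      by (simp add: inner_on_add_left inner_on_add_right inner_on_scale_left inner_on_scale_right
          vS rv power2_eq_square algebra_simps)
    have e2: "inner_on \<Omega> ?f (?L ?f) = m + 2 * t * inner_on \<Omega> r (?L v) + t\<^sup>2 * inner_on \<Omega> r (?L r)"
      by (simp add: inner_on_add_left inner_on_add_right inner_on_scale_left inner_on_scale_right
          kernel_op_add kernel_op_scale vLr m_def power2_eq_square algebra_simps)
    show "2 * t * inner_on \<Omega> r r + t\<^sup>2 * (inner_on \<Omega> r (?L r) - m * inner_on \<Omega> r r) \<ge> 0"
      using *[unfolded e1 e2] by (simp add: rr algebra_simps)
  qed
  with inner_on_self_pos[OF fin r] have "r = 0" by fastforce
  then have "?L v = fun_scale m v"
    by (auto simp: r_def fun_scale_def fun_eq_iff)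
  with vS min show thesis by (intro that)
qed

lemma exists_orthogonal:
  assumes "finite \<Omega>" "card \<Omega> \<ge> 2"
  obtains f where "f \<in> functions_on \<Omega>" "f \<noteq> 0" "inner_on \<Omega> f g = 0"
proof -
  obtain a b where ab: "a \<in> \<Omega>" "b \<in> \<Omega>" "a \<noteq> b"
    using assms card_le_Suc0_iff_eq[of \<Omega>] by fastforce
  \<comment> \<open>A point mass at \<open>a\<close> if that is already orthogonal to
    \<open>g\<close>; otherwise the values of \<open>g\<close> at \<open>a\<close> and
    \<open>b\<close>, swapped and with one sign changed.\<close>
  define f :: "'a \<Rightarrow> real" where "f = (if g a = 0 then (\<lambda>x. if x = a then 1 else 0)
      else (\<lambda>x. if x = a then g b else if x = b then - g a else 0))"
  have "inner_on \<Omega> f g = (\<Sum>x\<in>{a, b}. f x * g x)"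
    unfolding inner_on_def by (rule sum.mono_neutral_right) (use ab assms in \<open>auto simp: f_def\<close>)
  then have "inner_on \<Omega> f g = 0" using ab by (auto simp: f_def)
  moreover have "f a \<noteq> 0 \<or> f b \<noteq> 0" using ab by (auto simp: f_def)
  moreover have "f \<in> functions_on \<Omega>" using ab by (auto simp: functions_on_def f_def)
  ultimately show thesis using that by fastforce
qed

section \<open>The Dirichlet spectrum\<close>

lemma sum_abs_eq_1_iff:
  fixes d :: "int ^ 'n"
  shows "(\<Sum>i\<in>UNIV. \<bar>d $ i\<bar>) = 1 \<longleftrightarrow> (\<exists>i. d = axis i 1 \<or> d = - axis i 1)"
proof
  assume *: "(\<Sum>i\<in>UNIV. \<bar>d $ i\<bar>) = 1"
  then obtain i where i: "d $ i \<noteq> 0" by (metis abs_0 sum.neutral zero_neq_one)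
  have split: "\<bar>d $ i\<bar> + (\<Sum>j\<in>UNIV - {i}. \<bar>d $ j\<bar>) = 1"
    using * by (metis finite iso_tuple_UNIV_I sum.remove)
  moreover have "(\<Sum>j\<in>UNIV - {i}. \<bar>d $ j\<bar>) \<ge> 0" by (rule sum_nonneg) simp
  \<comment> \<open>A nonzero integer coordinate has absolute value at least 1, which exhausts the
    whole sum.\<close>
  ultimately have "\<bar>d $ i\<bar> = 1" and "(\<Sum>j\<in>UNIV - {i}. \<bar>d $ j\<bar>) = 0" using i by linarith+
  then have "d $ j = 0" if "j \<noteq> i" for j
    using that by (subst (asm) sum_nonneg_eq_0_iff) auto
  with \<open>\<bar>d $ i\<bar> = 1\<close> have "d = axis i (d $ i)" "d $ i = 1 \<or> d $ i = - 1"
    by (auto simp: vec_eq_iff axis_def abs_if split: if_splits)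
  moreover have "axis i (- 1) = - (axis i 1 :: int ^ 'n)" by (simp add: vec_eq_iff axis_def)
  ultimately show "\<exists>i. d = axis i 1 \<or> d = - axis i 1" by metis
next
  have "(\<Sum>j\<in>UNIV. \<bar>(axis i 1 :: int ^ 'n) $ j\<bar>) = 1" for i
    by (simp add: axis_def if_distrib cong: if_cong)
  then show "\<exists>i. d = axis i 1 \<or> d = - axis i 1 \<Longrightarrow> (\<Sum>i\<in>UNIV. \<bar>d $ i\<bar>) = 1" by auto
qed

lemma lattice_nbrs_eq:
  "lattice_nbrs x = range (\<lambda>i. x + axis i 1) \<union> range (\<lambda>i. x - axis i 1)"
proof -
  have "y \<in> lattice_nbrs x \<longleftrightarrow> (\<exists>i. x - y = axis i 1 \<or> x - y = - axis i 1)" for y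
    using sum_abs_eq_1_iff[of "x - y"] by (simp add: lattice_nbrs_def)
  moreover have "x - y = axis i 1 \<longleftrightarrow> y = x - axis i 1" "x - y = - axis i 1 \<longleftrightarrow> y = x + axis i 1" for y i
    by (auto simp: algebra_simps)
  ultimately show ?thesis by auto
qed

lemma axis_1_inject: "axis i (1::int) = axis j 1 \<Longrightarrow> i = j"
  by (simp add: axis_eq_axis)

lemma axis_1_neq_uminus: "axis i (1::int) \<noteq> - axis j 1"
  by (auto simp: vec_eq_iff axis_def intro!: exI[of _ i])

text \<open>The forward and backward neighbours form two disjoint families, each injectively indexed
  by the axes. The constant function 1 then yields the degree.\<close>

lemma sum_lattice_nbrs:
  fixes f :: "int ^ 'n \<Rightarrow> 'b::comm_monoid_add"
  shows "(\<Sum>y\<in>lattice_nbrs x. f y) = (\<Sum>i\<in>UNIV. f (x + axis i 1) + f (x - axis i 1))"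
proof -
  have "range (\<lambda>i. x + axis i 1) \<inter> range (\<lambda>i. x - axis i 1) = {}"
  proof -
    have False if "x + axis i 1 = x - axis j 1" for i j
      using that axis_1_neq_uminus[of i j] by (simp add: diff_conv_add_uminus del: add_uminus_conv_diff)
    then show ?thesis by auto
  qed
  then have "(\<Sum>y\<in>lattice_nbrs x. f y) =
      (\<Sum>y\<in>range (\<lambda>i. x + axis i 1). f y) + (\<Sum>y\<in>range (\<lambda>i. x - axis i 1). f y)"
    unfolding lattice_nbrs_eq by (rule sum.union_disjoint[rotated 2]) auto
  also have "\<dots> = (\<Sum>i\<in>UNIV. f (x + axis i 1)) + (\<Sum>i\<in>UNIV. f (x - axis i 1))"
    by (subst (1 2) sum.reindex) (auto intro!: injI dest: axis_1_inject)
  finally show ?thesis by (simp add: sum.distrib)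
qed

lemma finite_lattice_nbrs: "finite (lattice_nbrs x)"
  by (simp add: lattice_nbrs_eq)

lemma lattice_degree_eq: "lattice_degree (x :: int ^ 'n) = 2 * CARD('n)"
  using sum_lattice_nbrs[of "\<lambda>_. 1::nat" x] by (simp add: lattice_degree_def)

lemma dirichlet_laplacian_apply:
  fixes f :: "int ^ 'n \<Rightarrow> real"
  assumes "f \<in> functions_on \<Omega>" "x \<in> \<Omega>"
  shows "dirichlet_laplacian \<Omega> f x =
    (\<Sum>i\<in>UNIV. f (x + axis i 1) + f (x - axis i 1)) / (2 * real CARD('n)) - f x"
proof -
  have "extend_by_zero \<Omega> f = f"
    using assms(1) by (auto simp: extend_by_zero_def functions_on_def)
  with assms(2) show ?thesis
    by (simp add: dirichlet_laplacian_def laplacian_def sum_lattice_nbrs lattice_degree_eq)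
       (simp add: extend_by_zero_def laplacian_def sum_lattice_nbrs lattice_degree_eq)
qed

text \<open>The matrix \<open>I - P\<close>, where \<open>P\<close> is the transition matrix of
  simple random walk on the lattice.\<close>

definition dirichlet_kernel :: "int ^ 'n \<Rightarrow> int ^ 'n \<Rightarrow> real" where
  "dirichlet_kernel x y = of_bool (x = y) - of_bool (y \<in> lattice_nbrs x) / (2 * real CARD('n))"

lemma dirichlet_kernel_commute: "dirichlet_kernel x y = dirichlet_kernel y x"
  by (auto simp: dirichlet_kernel_def lattice_nbrs_def abs_minus_commute)

text \<open>Extension by zero turns the sum over all neighbours into a sum over the neighbours in
  \<Omega>. This makes the results on symmetric kernels available for the Dirichlet
  Laplacian.\<close>

lemma kernel_op_dirichlet_kernel:
  fixes f :: "int ^ 'n \<Rightarrow> real"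
  assumes "finite \<Omega>"
  shows "kernel_op \<Omega> dirichlet_kernel f = - dirichlet_laplacian \<Omega> f"
proof
  fix x
  show "kernel_op \<Omega> dirichlet_kernel f x = (- dirichlet_laplacian \<Omega> f) x"
  proof (cases "x \<in> \<Omega>")
    case True
    have "(\<Sum>y\<in>\<Omega>. of_bool (y \<in> lattice_nbrs x) * f y) = (\<Sum>y\<in>\<Omega> \<inter> lattice_nbrs x. f y)"
      using assms by (auto simp: sum.inter_restrict intro!: sum.cong)
    also have "\<dots> = (\<Sum>y\<in>lattice_nbrs x. extend_by_zero \<Omega> f y)"
      by (simp add: extend_by_zero_def Int_commute finite_lattice_nbrs flip: sum.inter_restrict)
    finally have "(\<Sum>y\<in>\<Omega>. of_bool (y \<in> lattice_nbrs x) * f y) = \<dots>" .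
    moreover have "(\<Sum>y\<in>\<Omega>. of_bool (x = y) * f y) = f x"
      using assms True by (simp add: of_bool_def if_distrib[of "\<lambda>t. t * _"] cong: if_cong)
    moreover have "(\<Sum>y\<in>\<Omega>. of_bool (y \<in> lattice_nbrs x) / (2 * real CARD('n)) * f y) =
        (\<Sum>y\<in>\<Omega>. of_bool (y \<in> lattice_nbrs x) * f y) / (2 * real CARD('n))"
      by (simp add: sum_divide_distrib)
    ultimately show ?thesis using True
      by (simp add: kernel_op_def dirichlet_kernel_def dirichlet_laplacian_def extend_by_zero_def
          laplacian_def lattice_degree_eq left_diff_distrib sum_subtractf)
  qed (simp add: kernel_op_def dirichlet_laplacian_def extend_by_zero_def)
qed

section \<open>Eigenspaces and the ordered list of eigenvalues\<close>

lemma dirichlet_eigenspace_orthogonal: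
  fixes \<Omega> :: "(int ^ 'n) set"
  assumes "finite \<Omega>" "f \<in> dirichlet_eigenspace \<Omega> \<mu>" "g \<in> dirichlet_eigenspace \<Omega> \<nu>" "\<mu> \<noteq> \<nu>"
  shows "inner_on \<Omega> f g = 0"
proof -
  have "\<mu> * inner_on \<Omega> f g = \<nu> * inner_on \<Omega> f g"
    using kernel_op_symmetric[of dirichlet_kernel \<Omega> f g, OF dirichlet_kernel_commute] assms
    by (simp add: kernel_op_dirichlet_kernel dirichlet_eigenspace_def
        inner_on_scale_left inner_on_scale_right)
  with assms(4) show ?thesis by simp
qed

text \<open>One nonzero eigenfunction per eigenvalue gives an orthogonal family, finite by the
  dimension bound. Finiteness is what lets \<open>sorted_list_of_set\<close> enumerate the
  spectrum.\<close>

lemma finite_dirichlet_spectrum: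
  fixes \<Omega> :: "(int ^ 'n) set"
  assumes fin: "finite \<Omega>"
  shows "finite (dirichlet_spectrum \<Omega>)"
proof -
  note orth = dirichlet_eigenspace_orthogonal[OF fin]
  have "\<forall>\<mu>\<in>dirichlet_spectrum \<Omega>. \<exists>f. f \<in> dirichlet_eigenspace \<Omega> \<mu> \<and> f \<noteq> 0"
    by (auto simp: dirichlet_spectrum_def)
  then obtain F where F: "\<And>\<mu>. \<mu> \<in> dirichlet_spectrum \<Omega> \<Longrightarrow> F \<mu> \<in> dirichlet_eigenspace \<Omega> \<mu>"
      "\<And>\<mu>. \<mu> \<in> dirichlet_spectrum \<Omega> \<Longrightarrow> F \<mu> \<noteq> 0" by metis
  have on: "dirichlet_eigenspace \<Omega> \<mu> \<subseteq> functions_on \<Omega>" for \<mu>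
    by (auto simp: dirichlet_eigenspace_def)
  have orthF: "inner_on \<Omega> f g = 0"
    if "f \<in> F ` dirichlet_spectrum \<Omega>" "g \<in> F ` dirichlet_spectrum \<Omega>" "f \<noteq> g" for f g
    using that by (auto intro!: orth F)
  have "inj_on F (dirichlet_spectrum \<Omega>)"
  proof (rule inj_onI, rule ccontr)
    fix \<mu> \<nu> assume *: "\<mu> \<in> dirichlet_spectrum \<Omega>" "\<nu> \<in> dirichlet_spectrum \<Omega>" "F \<mu> = F \<nu>" "\<mu> \<noteq> \<nu>"
    then have "inner_on \<Omega> (F \<mu>) (F \<mu>) = 0" using orth F by metis
    with inner_on_self_pos[OF fin _ F(2)[OF *(1)]] F(1)[OF *(1)] on show False by fastforce
  qed
  moreover have "finite (F ` dirichlet_spectrum \<Omega>)"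
    by (rule orthogonal_card_le_dim[OF fin order_refl _ _ orthF, THEN conjunct1])
       (use F on in \<open>fastforce+\<close>)
  ultimately show "finite (dirichlet_spectrum \<Omega>)" by (simp add: finite_image_iff)
qed

text \<open>Bridge from the list of eigenvalues to the variational principle: \<open>u\<close>
  minimises the Rayleigh quotient over all functions and \<open>v\<close> over those orthogonal to
  \<open>u\<close>. For upper bounds on the second eigenvalue, the inequality with \<open>m\<close>
  suffices.\<close>

lemma first_two_dirichlet_eigenvalues:
  fixes \<Omega> :: "(int ^ 'n) set"
  assumes fin: "finite \<Omega>" and card: "card \<Omega> \<ge> 2"
  obtains u v m where
    "u \<in> dirichlet_eigenspace \<Omega> (dirichlet_eigenvalue \<Omega> 1)" "inner_on \<Omega> u u = 1"
    "v \<in> dirichlet_eigenspace \<Omega> m" "inner_on \<Omega> v v = 1"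
    "dirichlet_eigenvalue \<Omega> 1 \<le> m" "dirichlet_eigenvalue \<Omega> 2 \<le> m"
    "\<And>f. f \<in> functions_on \<Omega> \<Longrightarrow> inner_on \<Omega> f u = 0 \<Longrightarrow>
      m * inner_on \<Omega> f f \<le> inner_on \<Omega> f (- dirichlet_laplacian \<Omega> f)"
proof -
  note K = kernel_op_dirichlet_kernel[OF fin]
  obtain f1 :: "int ^ 'n \<Rightarrow> real" where f1: "f1 \<in> functions_on \<Omega>" "f1 \<noteq> 0"
    using exists_orthogonal[OF fin card] by metis
  \<comment> \<open>With \<open>g = 0\<close> the orthogonality constraint is vacuous, so the
    minimiser lemma yields a global minimiser.\<close>
  have z: "kernel_op \<Omega> dirichlet_kernel 0 = fun_scale 0 0"
    by (auto simp: kernel_op_def fun_scale_def)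
  obtain u k where u: "u \<in> functions_on \<Omega>" "inner_on \<Omega> u 0 = 0" "inner_on \<Omega> u u = 1"
      "kernel_op \<Omega> dirichlet_kernel u = fun_scale k u"
      "\<And>f. f \<in> functions_on \<Omega> \<Longrightarrow> inner_on \<Omega> f 0 = 0 \<Longrightarrow>
        k * inner_on \<Omega> f f \<le> inner_on \<Omega> f (kernel_op \<Omega> dirichlet_kernel f)"
    using rayleigh_minimizer[OF fin dirichlet_kernel_commute z f1(1) inner_on_zero_right f1(2)] by blast
  obtain f2 where f2: "f2 \<in> functions_on \<Omega>" "f2 \<noteq> 0" "inner_on \<Omega> f2 u = 0"
    using exists_orthogonal[OF fin card] by metis
  obtain v m where v: "v \<in> functions_on \<Omega>" "inner_on \<Omega> v u = 0" "inner_on \<Omega> v v = 1"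
      "kernel_op \<Omega> dirichlet_kernel v = fun_scale m v"
      "\<And>f. f \<in> functions_on \<Omega> \<Longrightarrow> inner_on \<Omega> f u = 0 \<Longrightarrow>
        m * inner_on \<Omega> f f \<le> inner_on \<Omega> f (kernel_op \<Omega> dirichlet_kernel f)"
    using rayleigh_minimizer[OF fin dirichlet_kernel_commute u(4) f2(1,3,2)] by blast
  have uE: "u \<in> dirichlet_eigenspace \<Omega> k" and vE: "v \<in> dirichlet_eigenspace \<Omega> m"
    using u v by (auto simp: dirichlet_eigenspace_def K)
  have nz: "u \<noteq> 0" "v \<noteq> 0" using u(3) v(3) by (auto simp: inner_on_zero_left)
  have lower: "k \<le> \<mu>" if "\<mu> \<in> dirichlet_spectrum \<Omega>" for \<mu>
  proof -
    from that obtain f where f: "f \<in> functions_on \<Omega>" "- dirichlet_laplacian \<Omega> f = fun_scale \<mu> f" "f \<noteq> 0"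
      by (auto simp: dirichlet_spectrum_def dirichlet_eigenspace_def)
    then have "k * inner_on \<Omega> f f \<le> \<mu> * inner_on \<Omega> f f"
      using u(5)[OF f(1) inner_on_zero_right] by (simp add: inner_on_scale_right K)
    with inner_on_self_pos[OF fin f(1,3)] show ?thesis by simp
  qed
  have spec: "k \<in> dirichlet_spectrum \<Omega>" "m \<in> dirichlet_spectrum \<Omega>"
    using uE vE nz by (auto simp: dirichlet_spectrum_def)
  let ?d = "\<lambda>\<mu>. fun_space.dim (dirichlet_eigenspace \<Omega> \<mu>)"
  \<comment> \<open>Each eigenvalue thus fills at least one place of the list, as the index
    computations below require.\<close>
  have dim_pos: "?d \<mu> \<ge> 1" if \<mu>: "\<mu> \<in> dirichlet_spectrum \<Omega>" for \<mu>
  proof -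
    from \<mu> obtain f where f: "f \<in> dirichlet_eigenspace \<Omega> \<mu>" "f \<noteq> 0"
      by (auto simp: dirichlet_spectrum_def)
    show ?thesis
      using orthogonal_card_le_dim[OF fin, of "dirichlet_eigenspace \<Omega> \<mu>" "{f}"] f
      by (auto simp: dirichlet_eigenspace_def)
  qed
  define rest where "rest = sorted_list_of_set (dirichlet_spectrum \<Omega> - {k})"
  note finS = finite_dirichlet_spectrum[OF fin]
  have Min: "Min (dirichlet_spectrum \<Omega>) = k"
    using finS spec lower by (intro Min_eqI) auto
  then have "sorted_list_of_set (dirichlet_spectrum \<Omega>) = k # rest"
    using sorted_list_of_set_nonempty[OF finS] spec by (auto simp: rest_def)
  then have L: "dirichlet_eigenvalues \<Omega> =
      replicate (?d k) k @ concat (map (\<lambda>\<mu>. replicate (?d \<mu>) \<mu>) rest)"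
    by (simp add: dirichlet_eigenvalues_def)
  have lam1: "dirichlet_eigenvalue \<Omega> 1 = k"
    using dim_pos[OF spec(1)] by (simp add: dirichlet_eigenvalue_def L nth_append)
  have lam2: "dirichlet_eigenvalue \<Omega> 2 \<le> m"
  proof (cases "?d k \<ge> 2")
    case True
    then show ?thesis using lower[OF spec(2)] by (simp add: dirichlet_eigenvalue_def L nth_append)
  next
    case False
    then have d: "?d k = 1" using dim_pos[OF spec(1)] by linarith
    \<comment> \<open>Otherwise \<open>u\<close> and \<open>v\<close> would be two orthogonal
      members of a one-dimensional eigenspace.\<close>
    have "m \<noteq> k"
    proof
      assume "m = k"
      have "u \<noteq> v" using u(3) v(2) by auto
      moreover have "card {u, v} \<le> ?d k"
        by (rule orthogonal_card_le_dim[OF fin, THEN conjunct2])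
           (use uE vE nz v(2) \<open>m = k\<close> inner_on_commute[of \<Omega> u v] in
             \<open>auto simp: dirichlet_eigenspace_def\<close>)
      ultimately show False using d by simp
    qed
    then have m: "m \<in> set rest" using spec finS by (simp add: rest_def)
    \<comment> \<open>Here \<open>a\<close> is the second smallest point of the spectrum; as
      \<open>k\<close> fills one place only, \<open>a\<close> is the second entry of the
      list.\<close>
    then obtain a rest' where r: "rest = a # rest'" by (cases rest) auto
    have "sorted rest" by (simp add: rest_def)
    with m r have "a \<le> m" by auto
    moreover have "a \<in> dirichlet_spectrum \<Omega>"
      using r finS by (metis Diff_iff finite_Diff list.set_intros(1) rest_def set_sorted_list_of_set)
    ultimately show ?thesis using dim_pos[of a]
      by (simp add: dirichlet_eigenvalue_def L d r nth_append)
  qed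
  show thesis
    by (rule that[OF _ u(3) vE v(3) _ lam2 v(5)[unfolded K]]) (use uE lam1 lower spec in auto)
qed

section \<open>Trial functions and the spectral gap\<close>

text \<open>Translate the summation variable by \<open>e\<close>. The terms gained or lost at the
  boundary contain a factor \<open>f\<close> at a point outside \<Omega> and vanish.\<close>

lemma sum_shift:
  fixes f :: "'a::ab_group_add \<Rightarrow> real"
  assumes "finite \<Omega>" "f \<in> functions_on \<Omega>"
  shows "(\<Sum>x\<in>\<Omega>. h x * f x * f (x - e)) = (\<Sum>x\<in>\<Omega>. h (x + e) * f x * f (x + e))"
proof -
  have "(\<Sum>x\<in>\<Omega>. h x * f x * f (x - e)) = (\<Sum>x\<in>\<Omega> \<inter> {x. x - e \<in> \<Omega>}. h x * f x * f (x - e))"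
    by (rule sum.mono_neutral_right) (use assms in \<open>auto simp: functions_on_def\<close>)
  also have "\<dots> = (\<Sum>x\<in>\<Omega> \<inter> {x. x + e \<in> \<Omega>}. h (x + e) * f x * f (x + e))"
    by (rule sum.reindex_bij_witness[of _ "\<lambda>x. x + e" "\<lambda>x. x - e"]) auto
  also have "\<dots> = (\<Sum>x\<in>\<Omega>. h (x + e) * f x * f (x + e))"
    by (rule sum.mono_neutral_left) (use assms in \<open>auto simp: functions_on_def\<close>)
  finally show ?thesis .
qed

text \<open>The translate of \<Omega> may miss part of \<Omega>, and outside \<Omega> the function
  vanishes, so only an inequality remains.\<close>

lemma sum_shift_square_le:
  fixes f :: "'a::ab_group_add \<Rightarrow> real"
  assumes "finite \<Omega>" "f \<in> functions_on \<Omega>"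
  shows "(\<Sum>x\<in>\<Omega>. (f (x + e))\<^sup>2) \<le> inner_on \<Omega> f f"
proof -
  have "(\<Sum>x\<in>\<Omega>. (f (x + e))\<^sup>2) = (\<Sum>y\<in>(\<lambda>x. x + e) ` \<Omega>. (f y)\<^sup>2)"
    by (subst sum.reindex) (auto simp: inj_on_def)
  also have "\<dots> = (\<Sum>y\<in>(\<lambda>x. x + e) ` \<Omega> \<inter> \<Omega>. (f y)\<^sup>2)"
    by (rule sum.mono_neutral_right) (use assms in \<open>auto simp: functions_on_def\<close>)
  also have "\<dots> \<le> (\<Sum>y\<in>\<Omega>. (f y)\<^sup>2)"
    by (rule sum_mono2) (use assms in auto)
  finally show ?thesis by (simp add: inner_on_def power2_eq_square)
qed

text \<open>For \<open>e = axis i 1\<close> and the first eigenfunction this is the quantity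
  \<open>c\<^sub>i\<close> of the outline.\<close>

definition autocorr :: "'a::plus set \<Rightarrow> 'a \<Rightarrow> ('a \<Rightarrow> real) \<Rightarrow> real" where
  "autocorr \<Omega> e f = (\<Sum>x\<in>\<Omega>. f x * f (x + e))"

lemma autocorr_uminus:
  fixes f :: "'a::ab_group_add \<Rightarrow> real"
  assumes "finite \<Omega>" "f \<in> functions_on \<Omega>"
  shows "autocorr \<Omega> (- e) f = autocorr \<Omega> e f"
  using sum_shift[OF assms, of "\<lambda>_. 1" e] by (simp add: autocorr_def)

lemma sum_shift_diff_square_le:
  fixes f :: "'a::ab_group_add \<Rightarrow> real"
  assumes "finite \<Omega>" "f \<in> functions_on \<Omega>"
  shows "(\<Sum>x\<in>\<Omega>. (f (x + e) - f x)\<^sup>2) \<le> 2 * (inner_on \<Omega> f f - autocorr \<Omega> e f)"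
proof -
  have "(\<Sum>x\<in>\<Omega>. (f (x + e) - f x)\<^sup>2) =
      (\<Sum>x\<in>\<Omega>. (f (x + e))\<^sup>2) + inner_on \<Omega> f f - 2 * autocorr \<Omega> e f"
    by (simp add: inner_on_def autocorr_def sum_distrib_left power2_eq_square algebra_simps
        flip: sum.distrib sum_subtractf)
  with sum_shift_square_le[OF assms, of e] show ?thesis by simp
qed

lemma autocorr_ge:
  fixes f :: "'a::ab_group_add \<Rightarrow> real"
  assumes "finite \<Omega>" "f \<in> functions_on \<Omega>"
  shows "- inner_on \<Omega> f f \<le> autocorr \<Omega> e f"
proof -
  have "0 \<le> (\<Sum>x\<in>\<Omega>. (f (x + e) + f x)\<^sup>2)" by (rule sum_nonneg) simp
  also have "\<dots> = (\<Sum>x\<in>\<Omega>. (f (x + e))\<^sup>2) + inner_on \<Omega> f f + 2 * autocorr \<Omega> e f"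
    by (simp add: inner_on_def autocorr_def sum_distrib_left power2_eq_square algebra_simps
        flip: sum.distrib)
  finally show ?thesis using sum_shift_square_le[OF assms, of e] by simp
qed

text \<open>Pass through the middle value \<open>f x\<close>. Each of the two one-step differences
  contributes \<open>2 * 2\<close>, whence the constant 8.\<close>

lemma sum_central_diff_square_le:
  fixes f :: "'a::ab_group_add \<Rightarrow> real"
  assumes "finite \<Omega>" "f \<in> functions_on \<Omega>"
  shows "(\<Sum>x\<in>\<Omega>. (f (x + e) - f (x - e))\<^sup>2) \<le> 8 * (inner_on \<Omega> f f - autocorr \<Omega> e f)"
proof -
  have "(p - q)\<^sup>2 \<le> 2 * (p - r)\<^sup>2 + 2 * (q - r)\<^sup>2" for p q r :: real
    using zero_le_power2[of "p + q - 2 * r"] by (simp add: power2_eq_square algebra_simps)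
  then have "(\<Sum>x\<in>\<Omega>. (f (x + e) - f (x - e))\<^sup>2) \<le>
      (\<Sum>x\<in>\<Omega>. 2 * (f (x + e) - f x)\<^sup>2 + 2 * (f (x - e) - f x)\<^sup>2)"
    by (intro sum_mono)
  also have "\<dots> = 2 * (\<Sum>x\<in>\<Omega>. (f (x + e) - f x)\<^sup>2) + 2 * (\<Sum>x\<in>\<Omega>. (f (x + - e) - f x)\<^sup>2)"
    by (simp add: sum.distrib sum_distrib_left)
  finally show ?thesis
    using sum_shift_diff_square_le[OF assms, of e] sum_shift_diff_square_le[OF assms, of "- e"]
    by (simp add: autocorr_uminus[OF assms])
qed

text \<open>Summation by parts: after a shift by \<open>e\<close> the two halves differ only in the
  weight \<open>h\<close>, and there by exactly 1.\<close>

lemma sum_central_diff: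
  fixes f :: "'a::ab_group_add \<Rightarrow> real"
  assumes "finite \<Omega>" "f \<in> functions_on \<Omega>" and h: "\<And>x. h (x + e) = h x + 1"
  shows "(\<Sum>x\<in>\<Omega>. h x * f x * (f (x + e) - f (x - e))) = - autocorr \<Omega> e f"
proof -
  have "(\<Sum>x\<in>\<Omega>. h x * f x * (f (x + e) - f (x - e))) =
      (\<Sum>x\<in>\<Omega>. h x * f x * f (x + e)) - (\<Sum>x\<in>\<Omega>. h x * f x * f (x - e))"
    by (simp add: right_diff_distrib sum_subtractf)
  also have "\<dots> = (\<Sum>x\<in>\<Omega>. h x * f x * f (x + e) - h (x + e) * f x * f (x + e))"
    by (simp add: sum_shift[OF assms(1,2)] sum_subtractf)
  also have "\<dots> = - autocorr \<Omega> e f"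
    by (simp add: h autocorr_def algebra_simps flip: sum_negf)
  finally show ?thesis .
qed

section \<open>Energy identities and the trial function\<close>

lemma dirichlet_energy:
  fixes f :: "int ^ 'n \<Rightarrow> real"
  assumes "finite \<Omega>" "f \<in> functions_on \<Omega>"
  shows "inner_on \<Omega> f (- dirichlet_laplacian \<Omega> f) =
    inner_on \<Omega> f f - (\<Sum>i\<in>UNIV. autocorr \<Omega> (axis i 1) f) / real CARD('n)"
proof -
  have "inner_on \<Omega> f (- dirichlet_laplacian \<Omega> f) =
      (\<Sum>x\<in>\<Omega>. f x * f x - (\<Sum>i\<in>UNIV. f x * f (x + axis i 1) + f x * f (x - axis i 1)) / (2 * real CARD('n)))"
    unfolding inner_on_def
    by (intro sum.cong refl) (simp add: dirichlet_laplacian_apply[OF assms(2)] algebra_simps sum_distrib_left)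
  also have "\<dots> = inner_on \<Omega> f f -
      (\<Sum>i\<in>UNIV. \<Sum>x\<in>\<Omega>. f x * f (x + axis i 1) + f x * f (x - axis i 1)) / (2 * real CARD('n))"
    by (simp add: sum_subtractf inner_on_def sum.swap[of _ _ \<Omega>] flip: sum_divide_distrib)
  \<comment> \<open>Steps along \<open>axis i 1\<close> and its negative give equal correlations;
    the resulting 2 cancels against the degree \<open>2n\<close>.\<close>
  also have "(\<Sum>i\<in>UNIV. \<Sum>x\<in>\<Omega>. f x * f (x + axis i 1) + f x * f (x - axis i 1)) =
      2 * (\<Sum>i\<in>UNIV. autocorr \<Omega> (axis i 1) f)"
    using autocorr_uminus[OF assms] by (simp add: sum.distrib autocorr_def sum_distrib_left)
  finally show ?thesis by (simp add: fun_Compl_def)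
qed

lemma eigenvalue_eq_autocorr:
  fixes f :: "int ^ 'n \<Rightarrow> real"
  assumes "finite \<Omega>" "f \<in> dirichlet_eigenspace \<Omega> \<mu>" "inner_on \<Omega> f f = 1"
  shows "(\<Sum>i\<in>UNIV. autocorr \<Omega> (axis i 1) f) = real CARD('n) * (1 - \<mu>)"
  using dirichlet_energy[of \<Omega> f] assms
  by (simp add: dirichlet_eigenspace_def inner_on_scale_right field_simps)

text \<open>Each of the \<open>n\<close> autocorrelations is at least -1, while their sum is
  \<open>n (1 - \<mu>)\<close>.\<close>

lemma eigenvalue_le_2:
  fixes f :: "int ^ 'n \<Rightarrow> real"
  assumes "finite \<Omega>" "f \<in> dirichlet_eigenspace \<Omega> \<mu>" "inner_on \<Omega> f f = 1"
  shows "\<mu> \<le> 2"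
proof -
  have "(\<Sum>i\<in>(UNIV::'n set). - 1) \<le> (\<Sum>i\<in>UNIV. autocorr \<Omega> (axis i 1) f)"
    by (rule sum_mono) (use autocorr_ge[of \<Omega> f] assms in \<open>auto simp: dirichlet_eigenspace_def\<close>)
  then have "real CARD('n) * (1 - \<mu>) \<ge> real CARD('n) * (- 1)"
    by (simp add: eigenvalue_eq_autocorr[OF assms])
  then show ?thesis by (subst (asm) mult_le_cancel_left_pos) auto
qed

text \<open>Multiplication by \<open>h\<close> commutes with the steps along every axis except
  \<open>i\<close>. The commutator is the central difference of \<open>u\<close> along
  \<open>axis i 1\<close>, and summation by parts evaluates its pairing with
  \<open>f\<close>.\<close>

lemma trial_function_energy:
  fixes u :: "int ^ 'n \<Rightarrow> real"
  assumes fin: "finite \<Omega>" and u: "u \<in> dirichlet_eigenspace \<Omega> \<mu>"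
    and h: "h = (\<lambda>x. real_of_int (x $ i) - a)" and f: "f = (\<lambda>x. h x * u x)"
  shows "inner_on \<Omega> f (- dirichlet_laplacian \<Omega> f) =
    \<mu> * inner_on \<Omega> f f + autocorr \<Omega> (axis i 1) u / (2 * real CARD('n))"
proof -
  have uf: "u \<in> functions_on \<Omega>" and eig: "- dirichlet_laplacian \<Omega> u = fun_scale \<mu> u"
    using u by (auto simp: dirichlet_eigenspace_def)
  have ff: "f \<in> functions_on \<Omega>" using uf by (simp add: f functions_on_def)
  let ?N = "2 * real CARD('n)"
  have pointwise: "(- dirichlet_laplacian \<Omega> f) x =
      \<mu> * f x - (u (x + axis i 1) - u (x - axis i 1)) / ?N" if x: "x \<in> \<Omega>" for x
  proof -
    have shift: "h (x + axis j 1) = h x + of_bool (j = i)" "h (x - axis j 1) = h x - of_bool (j = i)" for j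
      by (auto simp: h axis_def)
    have "(\<Sum>j\<in>UNIV. f (x + axis j 1) + f (x - axis j 1)) =
        (\<Sum>j\<in>UNIV. h x * (u (x + axis j 1) + u (x - axis j 1))
          + (if j = i then u (x + axis i 1) - u (x - axis i 1) else 0))"
      by (rule sum.cong) (auto simp: f shift algebra_simps)
    then have *: "(\<Sum>j\<in>UNIV. f (x + axis j 1) + f (x - axis j 1)) =
        h x * (\<Sum>j\<in>UNIV. u (x + axis j 1) + u (x - axis j 1)) + (u (x + axis i 1) - u (x - axis i 1))"
      by (simp add: sum.distrib flip: sum_distrib_left)
    have "(- dirichlet_laplacian \<Omega> u) x = \<mu> * u x"
      unfolding eig by (simp add: fun_scale_def)
    then have "(\<Sum>j\<in>UNIV. u (x + axis j 1) + u (x - axis j 1)) / ?N = (1 - \<mu>) * u x"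
      by (simp add: dirichlet_laplacian_apply[OF uf x] algebra_simps)
    then have "(\<Sum>j\<in>UNIV. u (x + axis j 1) + u (x - axis j 1)) = (1 - \<mu>) * u x * ?N"
      by (simp add: divide_eq_eq)
    then show ?thesis
      by (simp add: dirichlet_laplacian_apply[OF ff x] * add_divide_distrib) (simp add: f algebra_simps)
  qed
  have "inner_on \<Omega> f (- dirichlet_laplacian \<Omega> f) =
      (\<Sum>x\<in>\<Omega>. \<mu> * (f x * f x) - h x * u x * (u (x + axis i 1) - u (x - axis i 1)) / ?N)"
    unfolding inner_on_def
    by (intro sum.cong refl, subst pointwise) (simp_all add: f algebra_simps)
  also have "\<dots> = \<mu> * inner_on \<Omega> f f - (\<Sum>x\<in>\<Omega>. h x * u x * (u (x + axis i 1) - u (x - axis i 1))) / ?N"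
    by (simp add: sum_subtractf inner_on_def flip: sum_distrib_left sum_divide_distrib)
  also have "(\<Sum>x\<in>\<Omega>. h x * u x * (u (x + axis i 1) - u (x - axis i 1))) = - autocorr \<Omega> (axis i 1) u"
    by (rule sum_central_diff[OF fin uf]) (simp add: h axis_def)
  finally show ?thesis by (simp add: fun_Compl_def)
qed

text \<open>The energy bound and the Cauchy-Schwarz bound both involve the squared norm
  \<open>V\<close> of the trial function; combining them eliminates \<open>V\<close>.\<close>

lemma gap_autocorr_le:
  fixes u :: "int ^ 'n \<Rightarrow> real"
  assumes fin: "finite \<Omega>" and u: "u \<in> dirichlet_eigenspace \<Omega> \<mu>" "inner_on \<Omega> u u = 1"
    and le: "\<mu> \<le> m"
    and min: "\<And>f. f \<in> functions_on \<Omega> \<Longrightarrow> inner_on \<Omega> f u = 0 \<Longrightarrow>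
      m * inner_on \<Omega> f f \<le> inner_on \<Omega> f (- dirichlet_laplacian \<Omega> f)"
  shows "0 \<le> autocorr \<Omega> (axis i 1) u"
    and "(m - \<mu>) * autocorr \<Omega> (axis i 1) u \<le> 4 * (1 - autocorr \<Omega> (axis i 1) u) / real CARD('n)"
proof -
  have uf: "u \<in> functions_on \<Omega>" using u by (auto simp: dirichlet_eigenspace_def)
  \<comment> \<open>The mean of the \<open>i\<close>-th coordinate under the probability weights
    \<open>u^2\<close>; this makes \<open>f\<close> orthogonal to \<open>u\<close>.\<close>
  define a where "a = (\<Sum>x\<in>\<Omega>. real_of_int (x $ i) * u x * u x)"
  define h where "h = (\<lambda>x :: int ^ 'n. real_of_int (x $ i) - a)"
  define f where "f = (\<lambda>x. h x * u x)"
  define V where "V = inner_on \<Omega> f f"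
  define c where "c = autocorr \<Omega> (axis i 1) u"
  define n where "n = real CARD('n)"
  have n: "n > 0" by (simp add: n_def)
  have "inner_on \<Omega> f u = a - a * inner_on \<Omega> u u"
    by (simp add: inner_on_def f_def h_def a_def left_diff_distrib sum_subtractf sum_distrib_left mult.assoc)
  moreover have "f \<in> functions_on \<Omega>" using uf by (simp add: functions_on_def f_def)
  ultimately have "m * V \<le> \<mu> * V + c / (2 * n)"
    using min[of f] trial_function_energy[OF fin u(1) h_def f_def] u(2) by (simp add: V_def c_def n_def)
  then have gap: "(m - \<mu>) * V \<le> c / (2 * n)" by (simp add: algebra_simps)
  have "V \<ge> 0" unfolding V_def by (rule inner_on_self_nonneg)
  with le have "0 \<le> (m - \<mu>) * V" by simp
  with gap have "0 \<le> c / (2 * n)" by linarith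
  with n have c: "0 \<le> c" by (simp add: zero_le_divide_iff)
  then show "0 \<le> autocorr \<Omega> (axis i 1) u" by (simp add: c_def)
  let ?D = "\<Sum>x\<in>\<Omega>. (u (x + axis i 1) - u (x - axis i 1))\<^sup>2"
  have D: "?D \<le> 8 * (1 - c)" "?D \<ge> 0"
    using sum_central_diff_square_le[OF fin uf, of "axis i 1"] u(2) by (auto simp: c_def intro: sum_nonneg)
  have "(\<Sum>x\<in>\<Omega>. h x * u x * (u (x + axis i 1) - u (x - axis i 1))) = - c"
    unfolding c_def by (rule sum_central_diff[OF fin uf]) (simp add: h_def axis_def)
  then have "c\<^sup>2 = (\<Sum>x\<in>\<Omega>. f x * (u (x + axis i 1) - u (x - axis i 1)))\<^sup>2"
    by (simp add: f_def)
  also have "\<dots> \<le> V * ?D"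
    using Cauchy_Schwarz_ineq_sum[of f _ \<Omega>] by (simp add: V_def inner_on_def power2_eq_square)
  also have "\<dots> \<le> V * (8 * (1 - c))"
    using D \<open>V \<ge> 0\<close> by (intro mult_left_mono)
  \<comment> \<open>The factor \<open>(m - \<mu>) V\<close> can now be replaced by its bound
    \<open>c / (2n)\<close>, and \<open>8 / 2\<close> gives the constant 4.\<close>
  finally have "(m - \<mu>) * c\<^sup>2 \<le> (m - \<mu>) * (V * (8 * (1 - c)))"
    using le by (intro mult_left_mono) auto
  also have "\<dots> = (m - \<mu>) * V * (8 * (1 - c))" by simp
  also have "\<dots> \<le> c / (2 * n) * (8 * (1 - c))"
    using gap D by (intro mult_right_mono) auto
  also have "\<dots> = c * (4 * (1 - c) / n)" using n by (simp add: field_simps)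
  finally have main: "c * ((m - \<mu>) * c) \<le> c * (4 * (1 - c) / n)"
    by (simp only: power2_eq_square mult_ac)
  \<comment> \<open>The common factor \<open>c\<close> cancels if it is positive. If
    \<open>c = 0\<close>, the left side is 0 and the right side is \<open>4 / n\<close>.\<close>
  show "(m - \<mu>) * autocorr \<Omega> (axis i 1) u \<le> 4 * (1 - autocorr \<Omega> (axis i 1) u) / real CARD('n)"
  proof (cases "c = 0")
    case True
    then show ?thesis by (simp flip: c_def)
  next
    case False
    with c main have "(m - \<mu>) * c \<le> 4 * (1 - c) / n"
      by (metis less_eq_real_def mult_le_cancel_left_pos)
    then show ?thesis by (simp add: c_def n_def)
  qed
qed

theorem corollary1p2:
  fixes \<Omega> :: "(int ^ 'n) set"
    and lam :: "nat \<Rightarrow> real"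
  assumes "finite \<Omega>"
    and "card \<Omega> \<ge> 2"
    and "\<And>i. lam i = dirichlet_eigenvalue \<Omega> i"
  shows "(lam 1 \<noteq> 1 \<longrightarrow>
            lam 2 - lam 1 \<le> 4 * lam 1 / (real CARD('n) * (1 - lam 1)))
       \<and> lam 2 \<le> 9 * lam 1"
proof -
  note fin = assms(1)
  obtain u v m where u: "u \<in> dirichlet_eigenspace \<Omega> (lam 1)" "inner_on \<Omega> u u = 1"
    and v: "v \<in> dirichlet_eigenspace \<Omega> m" "inner_on \<Omega> v v = 1"
    and m: "lam 1 \<le> m" "lam 2 \<le> m"
    and min: "\<And>f. f \<in> functions_on \<Omega> \<Longrightarrow> inner_on \<Omega> f u = 0 \<Longrightarrow>
      m * inner_on \<Omega> f f \<le> inner_on \<Omega> f (- dirichlet_laplacian \<Omega> f)"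
    using first_two_dirichlet_eigenvalues[OF assms(1,2)] unfolding assms(3) by blast
  define n where "n = real CARD('n)"
  have n: "n \<ge> 1" by (simp add: n_def Suc_leI)
  let ?c = "\<lambda>i. autocorr \<Omega> (axis i 1) u"
  note c = gap_autocorr_le[OF fin u m(1) min]
  have sum_c: "(\<Sum>i\<in>UNIV. ?c i) = n * (1 - lam 1)"
    unfolding n_def by (rule eigenvalue_eq_autocorr[OF fin u])
  have "0 \<le> n * (1 - lam 1)"
    unfolding sum_c[symmetric] by (intro sum_nonneg c(1))
  \<comment> \<open>Nonnegativity of all \<open>c\<^sub>i\<close> gives the sign needed to divide by
    \<open>1 - lam 1\<close> later.\<close>
  with n have lam1: "lam 1 \<le> 1" by (simp add: zero_le_mult_iff)
  have "(m - lam 1) * (n * (1 - lam 1)) = (\<Sum>i\<in>UNIV. (m - lam 1) * ?c i)"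
    by (simp add: sum_c flip: sum_distrib_left)
  also have "\<dots> \<le> (\<Sum>i\<in>UNIV. 4 * (1 - ?c i) / n)"
    unfolding n_def by (intro sum_mono c(2))
  also have "\<dots> = 4 * (n - n * (1 - lam 1)) / n"
    by (simp add: sum_subtractf sum_c n_def flip: sum_divide_distrib sum_distrib_left)
  also have "\<dots> = 4 * lam 1" using n by (simp add: field_simps)
  finally have gap: "(m - lam 1) * (n * (1 - lam 1)) \<le> 4 * lam 1" .
  have "lam 2 - lam 1 \<le> 4 * lam 1 / (n * (1 - lam 1))" if "lam 1 \<noteq> 1"
  proof -
    have "n * (1 - lam 1) > 0" using that lam1 n by simp
    with gap have "m - lam 1 \<le> 4 * lam 1 / (n * (1 - lam 1))" by (simp add: pos_le_divide_eq)
    with m(2) show ?thesis by linarith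
  qed
  moreover have "lam 2 \<le> 9 * lam 1"
  proof (cases "lam 1 \<le> 1 / 2")
    case True
    \<comment> \<open>Since \<open>n \<ge> 1\<close>, the factor \<open>n (1 - lam 1)\<close> is at
      least 1/2, so the gap is at most \<open>8 * lam 1\<close>.\<close>
    have "(m - lam 1) * (1 / 2) \<le> (m - lam 1) * (n * (1 - lam 1))"
      using m(1) True mult_mono[of 1 n "1 / 2" "1 - lam 1"] n by (intro mult_left_mono) auto
    with gap have "(m - lam 1) * (1 / 2) \<le> 4 * lam 1" by (rule order_trans[rotated])
    with m(2) show ?thesis by argo
  next
    \<comment> \<open>Here \<open>9 * lam 1\<close> exceeds 9/2, whereas
      \<open>m \<le> 2\<close>.\<close>
    case False
    with eigenvalue_le_2[OF fin v] m(2) show ?thesis by linarith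
  qed
  ultimately show ?thesis by (simp add: n_def)
qed

end
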